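(* Let $G$ be a $(z,w)$-colored graph with exactly one vertex, say $j$, colored $w$ and all other vertices colored $z$. Let $i$ be a vertex of $G$ that is connected to $j$ by a path, and let $n$ be the minimum length of a path from $i$ to $j$ (with $n=0$ if $i=j$). Then the order of contact, at $(\infty,0)$, of the representing function $f_G^i(z,w)$ of $G$ at vertex $i$ is $2n$.
   Context: Graphs are finite, simple and undirected. A $(z,w)$-colored graph is such a graph $G$ with each vertex labelled (colored) by one of the two variables $z$ or $w$. Its colored adjacency matrix is $\mathcal{A}_G = A_G - D$, where $A_G$ is the usual $0/1$ adjacency matrix and $D$ is the diagonal matrix whose $k$-th diagonal entry is the color ($z$ or $w$) of vertex $k$. The representing function (Nevanlinna representation) of $G$ at vertex $i$ is the rational function $f_G^i(z,w) = (\mathcal{A}_G^{-1})_{(i,i)}$, the $(i,i)$ entry of the inverse matrix. The length of a path is its number of edges. Order of contact: write $f=f_G^i$. For all but finitely many $\lambda\in\mathbb{R}$, the equation $f(z,w)=\lambda$ can be solved for $w$ in the form $w=\Lambda_\lambda(z)$, with $\Lambda_\lambda$ analytic in a neighborhood of $z=\infty$ (i.e. a convergent power series in $1/z$). The order of contact of $f$ is the order of vanishing at $z=\infty$ of the difference $\Lambda_\lambda(z)-\Lambda_\mu(z)$ for generic $\lambda\neq\mu$, that is: it equals $N$ if there is a finite set $F\subset\mathbb{R}$ such that for all distinct $\lambda,\mu\in\mathbb{R}\setminus F$, the expansion of $\Lambda_\lambda-\Lambda_\mu$ in powers of $1/z$ has lowest-order nonzero term of order exactly $(1/z)^N$. 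*)

theory Defs
  imports "HOL-Analysis.Analysis" "Graph_Theory.Graph_Theory"
begin

datatype color = Z | W

fun color_value :: "color \<Rightarrow> complex \<Rightarrow> complex \<Rightarrow> complex" where
  "color_value Z z w = z"
| "color_value W z w = w"

definition adj_matrix :: "'v::finite pair_pre_digraph \<Rightarrow> complex^'v^'v" where
  "adj_matrix G = (\<chi> k l. if (k, l) \<in> parcs G then 1 else 0)"

definition color_matrix :: "('v::finite \<Rightarrow> color) \<Rightarrow> complex \<Rightarrow> complex \<Rightarrow> complex^'v^'v" where
  "color_matrix c z w = (\<chi> k l. if k = l then color_value (c k) z w else 0)"

definition colored_adj_matrix ::
    "'v::finite pair_pre_digraph \<Rightarrow> ('v \<Rightarrow> color) \<Rightarrow> complex \<Rightarrow> complex \<Rightarrow> complex^'v^'v" where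
  "colored_adj_matrix G c z w = adj_matrix G - color_matrix c z w"

text \<open>
  The rational function \<open>(A\<^sub>G - D)\<inverse>\<^sub>(\<^sub>i\<^sub>,\<^sub>i\<^sub>)\<close> as a partial function of two complex variables. It is
  \<open>None\<close> where the matrix is singular, since \<open>matrix_inv\<close> is meaningless there. The
  determinant is not the zero polynomial in \<open>z\<close> and \<open>w\<close>.
\<close>

definition representing_function ::
    "'v::finite pair_pre_digraph \<Rightarrow> ('v \<Rightarrow> color) \<Rightarrow> 'v \<Rightarrow> complex \<Rightarrow> complex \<Rightarrow> complex option" where
  "representing_function G c i z w =
     (if invertible (colored_adj_matrix G c z w)
      then Some (matrix_inv (colored_adj_matrix G c z w) $ i $ i) else None)"

text \<open>
  The equation \<open>f(z,w) = \<alpha>\<close> is solved for \<open>w\<close> near \<open>z = \<infinity>\<close> by \<open>w = \<Lambda>(1/z)\<close>, where \<open>\<Lambda>\<close> is a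
  convergent power series. The equivalence determines \<open>\<Lambda>\<close> uniquely.
\<close>

definition solved_at_infinity ::
    "(complex \<Rightarrow> complex \<Rightarrow> complex option) \<Rightarrow> real \<Rightarrow> complex fps \<Rightarrow> bool" where
  "solved_at_infinity f \<alpha> \<Lambda> \<longleftrightarrow>
     fps_conv_radius \<Lambda> > 0 \<and>
     (\<forall>\<^sub>F z in at_infinity. \<forall>w. f z w = Some (of_real \<alpha>) \<longleftrightarrow> w = eval_fps \<Lambda> (1 / z))"

text \<open>
  The lowest-order nonzero term of a nonzero power series has order \<open>subdegree\<close>; the
  nonzeroness is stated separately because \<open>subdegree 0 = 0\<close>. No condition is imposed on the
  value of \<open>\<Lambda> \<alpha>\<close> at \<open>z = \<infinity>\<close>: for a single vertex of color
  \<open>W\<close> one has \<open>f(z,w) = -1/w\<close> and \<open>\<Lambda> \<alpha> = -1/\<alpha>\<close>.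
\<close>

definition has_order_of_contact ::
    "(complex \<Rightarrow> complex \<Rightarrow> complex option) \<Rightarrow> nat \<Rightarrow> bool" where
  "has_order_of_contact f N \<longleftrightarrow>
     (\<exists>F \<Lambda>. finite F \<and>
        (\<forall>\<alpha>. \<alpha> \<notin> F \<longrightarrow> solved_at_infinity f \<alpha> (\<Lambda> \<alpha>)) \<and>
        (\<forall>\<alpha> \<beta>. \<alpha> \<notin> F \<longrightarrow> \<beta> \<notin> F \<longrightarrow> \<alpha> \<noteq> \<beta> \<longrightarrow>
           \<Lambda> \<alpha> - \<Lambda> \<beta> \<noteq> 0 \<and> subdegree (\<Lambda> \<alpha> - \<Lambda> \<beta>) = N))"

text \<open>
  \<open>pre_digraph.apath\<close> is a path without repeated vertices, given as a list of arcs, so the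
  \<open>length\<close> of that list is the number of edges; the empty list is the path from a vertex to itself.
\<close>

definition path_between :: "'v pair_pre_digraph \<Rightarrow> 'v \<Rightarrow> ('v \<times> 'v) list \<Rightarrow> 'v \<Rightarrow> bool" where
  "path_between G u p v \<longleftrightarrow> pre_digraph.apath (with_proj G) u p v"

definition min_path_length :: "'v pair_pre_digraph \<Rightarrow> 'v \<Rightarrow> 'v \<Rightarrow> nat" where
  "min_path_length G u v = (LEAST m. \<exists>p. path_between G u p v \<and> length p = m)"

end

theory Submission
  imports Defs
begin

text \<open>
  Put \<open>t = 1/z\<close> and let \<open>p\<^sub>k\<^sub>l(t) = \<Sum>\<^sub>m (A\<^sup>m)\<^sub>k\<^sub>l t\<^sup>m\<close> be the generating function of the walks from \<open>k\<close> to \<open>l\<close>,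
  so that \<open>A - z\<close> has the inverse \<open>-t p(t)\<close> for large \<open>z\<close>. The colored adjacency matrix is the
  perturbation of \<open>A - z\<close> by \<open>z - w\<close> in the single entry \<open>(j, j)\<close>. The rank-one update formula for
  the inverse makes \<open>f = \<alpha>\<close> linear in \<open>w\<close>, and its solutions satisfy
  \<open>\<Lambda>\<^sub>\<alpha> - \<Lambda>\<^sub>\<beta> = (\<alpha> - \<beta>) p\<^sub>i\<^sub>j\<^sup>2 / (d\<^sub>\<alpha> d\<^sub>\<beta>)\<close> with \<open>d\<^sub>\<alpha>(0) = -\<alpha>\<close>. For nonzero \<open>\<alpha>\<close> and \<open>\<beta>\<close> the order is
  therefore twice the order of \<open>p\<^sub>i\<^sub>j\<close>, and the first nonzero coefficient of \<open>p\<^sub>i\<^sub>j\<close> counts the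
  shortest walks from \<open>i\<close> to \<open>j\<close>.
\<close>

section \<open>Counting walks\<close>

primrec walk_count :: "('v::finite \<times> 'v) set \<Rightarrow> nat \<Rightarrow> 'v \<Rightarrow> 'v \<Rightarrow> nat" where
  "walk_count E 0 u v = (if u = v then 1 else 0)"
| "walk_count E (Suc m) u v = (\<Sum>x | (u, x) \<in> E. walk_count E m x v)"

text \<open>The defining recursion splits off the first arc; splitting off the last one instead is
  what allows walks to be reversed.\<close>

lemma walk_count_Suc_right:
  "walk_count E (Suc m) u v = (\<Sum>x | (x, v) \<in> E. walk_count E m u x)"
proof (induction m arbitrary: u)
  case 0
  show ?case
    by simp
next
  case (Suc m)
  have "walk_count E (Suc (Suc m)) u v = (\<Sum>y | (u, y) \<in> E. \<Sum>x | (x, v) \<in> E. walk_count E m y x)"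
    using Suc.IH by simp
  also have "\<dots> = (\<Sum>x | (x, v) \<in> E. walk_count E (Suc m) u x)"
    by (subst sum.swap) simp
  finally show ?case .
qed

lemma walk_count_commute:
  assumes "sym E"
  shows "walk_count E m u v = walk_count E m v u"
proof (induction m arbitrary: u)
  case (Suc m)
  have "{x. (u, x) \<in> E} = {x. (x, u) \<in> E}"
    using assms by (auto dest: symD)
  with Suc.IH have "walk_count E (Suc m) u v = (\<Sum>x | (x, u) \<in> E. walk_count E m v x)"
    by simp
  then show ?case
    by (simp only: walk_count_Suc_right)
qed simp

text \<open>Each step has at most \<open>CARD('v)\<close> continuations. This crude bound gives the
  walk series a positive radius of convergence.\<close>

lemma walk_count_le: "walk_count (E :: ('v::finite \<times> 'v) set) m u v \<le> CARD('v) ^ m"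
proof (induction m arbitrary: u)
  case (Suc m)
  have "walk_count E (Suc m) u v \<le> (\<Sum>x | (u, x) \<in> E. CARD('v) ^ m)"
    unfolding walk_count.simps by (intro sum_mono Suc.IH)
  also have "\<dots> \<le> CARD('v) ^ Suc m"
    by (simp add: card_mono)
  finally show ?case .
qed simp

text \<open>Links the coefficients to the walks of the graph library. Every vertex must lie in
  \<open>pverts G\<close> because the library admits the empty walk only at vertices of the
  graph.\<close>

lemma walk_count_pos_iff:
  assumes "pair_wf_digraph G" and "pverts G = UNIV"
  shows "0 < walk_count (parcs G) m u v \<longleftrightarrow>
    (\<exists>p. pre_digraph.awalk (with_proj G) u p v \<and> length p = m)"
proof -
  interpret pair_wf_digraph G by fact
  show ?thesis
  proof (induction m arbitrary: u)
    case 0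
    show ?case
      using assms(2) by (auto simp: awalk_Nil_iff)
  next
    case (Suc m)
    have "0 < walk_count (parcs G) (Suc m) u v \<longleftrightarrow>
        (\<exists>x. (u, x) \<in> parcs G \<and> 0 < walk_count (parcs G) m x v)"
      by (auto simp: neq0_conv[symmetric] simp del: neq0_conv)
    also have "\<dots> \<longleftrightarrow> (\<exists>p. awalk u p v \<and> length p = Suc m)"
    proof
      assume "\<exists>x. (u, x) \<in> parcs G \<and> 0 < walk_count (parcs G) m x v"
      then obtain x p where "(u, x) \<in> parcs G" "awalk x p v" "length p = m"
        unfolding Suc.IH by blast
      then have "awalk u ((u, x) # p) v \<and> length ((u, x) # p) = Suc m"
        by (simp add: awalk_Cons_iff)
      then show "\<exists>p. awalk u p v \<and> length p = Suc m"
        by blast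
    next
      assume "\<exists>p. awalk u p v \<and> length p = Suc m"
      then obtain e p where "awalk u (e # p) v" "length p = m"
        by (auto simp: length_Suc_conv)
      then have "(u, snd e) \<in> parcs G \<and> awalk (snd e) p v"
        by (cases e) (simp add: awalk_Cons_iff)
      with \<open>length p = m\<close> show "\<exists>x. (u, x) \<in> parcs G \<and> 0 < walk_count (parcs G) m x v"
        unfolding Suc.IH by blast
    qed
    finally show ?case .
  qed
qed

text \<open>Removing cycles one at a time never lengthens a walk. This is needed because the
  coefficients count walks while the distance is a minimum over paths.\<close>

lemma (in wf_digraph) awalk_imp_shorter_apath:
  assumes "awalk u p v"
  shows "\<exists>q. apath u q v \<and> length q \<le> length p"
  using assms
proof (induction rule: awalk_to_apath_induct)
  case (path p)
  then show ?case
    by (auto simp: apath_def)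
next
  case (decomp p q r s)
  then have "length (q @ s) \<le> length p"
    by (auto elim: awalk_cyc_decompE)
  with decomp show ?case
    by (meson le_trans)
qed

section \<open>Generating functions of walks\<close>

definition walk_fps :: "('v::finite \<times> 'v) set \<Rightarrow> 'v \<Rightarrow> 'v \<Rightarrow> complex fps" where
  "walk_fps E u v = Abs_fps (\<lambda>m. of_nat (walk_count E m u v))"

lemma walk_fps_nth: "fps_nth (walk_fps E u v) m = of_nat (walk_count E m u v)"
  by (simp add: walk_fps_def)

lemma fps_conv_radius_walk_fps: "fps_conv_radius (walk_fps (E :: ('v::finite \<times> 'v) set) u v) > 0"
proof -
  \<comment> \<open>With this radius, \<open>CARD('v) * r\<close> is \<open>1 / 2\<close>, so a
    geometric series dominates.\<close>
  define r where "r = 1 / (2 * real CARD('v))"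
  have r: "r > 0"
    by (simp add: r_def)
  have "summable (\<lambda>m. fps_nth (walk_fps E u v) m * of_real r ^ m)"
  proof (rule summable_comparison_test')
    show "summable (\<lambda>m. (1 / 2 :: real) ^ m)"
      by (rule summable_geometric) simp
    fix m :: nat
    have "norm (fps_nth (walk_fps E u v) m * of_real r ^ m) = real (walk_count E m u v) * r ^ m"
      using r by (simp add: walk_fps_nth norm_mult norm_power)
    also have "\<dots> \<le> real (CARD('v) ^ m) * r ^ m"
      using r walk_count_le[of E m u v] by (intro mult_right_mono) (auto simp flip: of_nat_power)
    also have "\<dots> = (1 / 2) ^ m"
      by (simp add: r_def flip: power_mult_distrib)
    finally show "norm (fps_nth (walk_fps E u v) m * of_real r ^ m) \<le> (1 / 2) ^ m" .
  qed
  from conv_radius_geI[OF this] r have "ereal r \<le> fps_conv_radius (walk_fps E u v)"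
    by (simp add: fps_conv_radius_def)
  with r show ?thesis
    by (meson ereal_less(2) less_le_trans)
qed

lemma has_fps_expansion_walk_fps: "eval_fps (walk_fps E u v) has_fps_expansion walk_fps E u v"
  by (intro eval_fps_has_fps_expansion fps_conv_radius_walk_fps)

text \<open>Decomposition of a walk by its first step; in matrix form,
  \<open>p = 1 + t A p\<close>.\<close>

lemma walk_fps_unfold:
  "walk_fps E u v =
    fps_const (if u = v then 1 else 0) + fps_X * (\<Sum>x | (u, x) \<in> E. walk_fps E x v)"
proof (rule fps_ext)
  fix m
  show "fps_nth (walk_fps E u v) m = fps_nth (fps_const (if u = v then 1 else 0)
      + fps_X * (\<Sum>x | (u, x) \<in> E. walk_fps E x v)) m"
    by (cases m) (auto simp: walk_fps_nth fps_sum_nth)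
qed

lemma has_fps_expansion_unique_eventually:
  assumes "f has_fps_expansion F" and "g has_fps_expansion F"
  shows "\<forall>\<^sub>F t in nhds 0. f t = g t"
  using assms unfolding has_fps_expansion_def by (auto elim: eventually_elim2)

lemma eventually_eval_walk_fps_unfold:
  "\<forall>\<^sub>F t in nhds 0. eval_fps (walk_fps E u v) t =
     (if u = v then 1 else 0) + t * (\<Sum>x | (u, x) \<in> E. eval_fps (walk_fps E x v) t)"
  by (rule has_fps_expansion_unique_eventually[OF has_fps_expansion_walk_fps], subst walk_fps_unfold)
    (intro fps_expansion_intros has_fps_expansion_walk_fps)

text \<open>Dividing by \<open>t ^ n\<close>, with \<open>n\<close> the order of \<open>F\<close>,
  leaves a function continuous at 0 with nonzero value there.\<close>

lemma has_fps_expansion_eventually_nonzero: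
  fixes F :: "'a::{banach, real_normed_field} fps"
  assumes "f has_fps_expansion F" and "F \<noteq> 0"
  shows "\<forall>\<^sub>F t in at 0. f t \<noteq> 0"
proof -
  define n c where "n = subdegree F" and "c = fps_nth F n"
  define g where "g = (\<lambda>t. if t = 0 then c else f t / t ^ n)"
  have "g has_fps_expansion fps_shift n F"
    unfolding g_def by (intro has_fps_expansion_shift assms) (auto simp: n_def c_def)
  then have "continuous (at 0) g"
    by (rule has_fps_expansion_imp_continuous)
  then have "g \<midarrow>0\<rightarrow> c"
    by (simp add: isCont_def g_def)
  moreover have "c \<noteq> 0"
    using assms(2) by (simp add: c_def n_def)
  ultimately have "\<forall>\<^sub>F t in at 0. g t \<noteq> 0"
    by (rule tendsto_imp_eventually_ne)
  then show ?thesis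
    using eventually_neq_at_within[of 0 0 UNIV] by eventually_elim (auto simp: g_def)
qed

section \<open>Rank-one perturbation of an inverse matrix\<close>

lemma matrix_inv_unique:
  fixes A :: "'a::field^'n^'n"
  assumes "A ** B = mat 1"
  shows "invertible A" and "matrix_inv A = B"
proof -
  have "B ** A = mat 1"
    using assms by (simp add: matrix_left_right_inverse)
  with assms show "invertible A"
    by (auto simp: invertible_def)
  then have "matrix_inv A ** A = mat 1"
    unfolding invertible_def matrix_inv_def by (rule someI2_ex) simp
  with assms show "matrix_inv A = B"
    by (metis matrix_mul_assoc matrix_mul_lid matrix_mul_rid)
qed

text \<open>The Sherman-Morrison formula for an update in the single entry \<open>(j, j)\<close>.
  The scalar \<open>1 + s * R $ j $ j\<close> is the ratio of the determinants of \<open>M\<close>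
  and \<open>B\<close>, which is why it decides invertibility.\<close>

lemma rank_one_perturbation:
  fixes B R M :: "'a::field^'n^'n"
  assumes "B ** R = mat 1"
    and M: "\<And>k l. M $ k $ l = B $ k $ l + (if k = j \<and> l = j then s else 0)"
  shows "invertible M \<longleftrightarrow> 1 + s * R $ j $ j \<noteq> 0"
    and "invertible M \<Longrightarrow> matrix_inv M $ k $ l =
      R $ k $ l - s * R $ k $ j * R $ j $ l / (1 + s * R $ j $ j)"
proof -
  have BR: "(\<Sum>x\<in>UNIV. B $ k $ x * R $ x $ l) = (if k = l then 1 else 0)" for k l
    using assms(1) by (auto simp: vec_eq_iff matrix_matrix_mult_def mat_def)
  have M_sum: "(\<Sum>x\<in>UNIV. M $ k $ x * f x) =
      (\<Sum>x\<in>UNIV. B $ k $ x * f x) + (if k = j then s * f j else 0)" for k f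
  proof -
    have "(\<Sum>x\<in>UNIV. M $ k $ x * f x) =
        (\<Sum>x\<in>UNIV. B $ k $ x * f x + (if x = j then if k = j then s * f j else 0 else 0))"
      by (intro sum.cong) (auto simp: M algebra_simps)
    also have "\<dots> = (\<Sum>x\<in>UNIV. B $ k $ x * f x) + (if k = j then s * f j else 0)"
      by (simp add: sum.distrib)
    finally show ?thesis .
  qed
  define q where "q = s / (1 + s * R $ j $ j)"
  define N where "N = (\<chi> k l. R $ k $ l - q * R $ k $ j * R $ j $ l)"
  have MN: "M ** N = mat 1" if "1 + s * R $ j $ j \<noteq> 0"
  proof -
    \<comment> \<open>Off row \<open>j\<close> the product \<open>M ** N\<close> is already the
      identity; this equation removes the remaining terms in row \<open>j\<close>.\<close>
    have q: "s - q - s * q * R $ j $ j = 0"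
      using that by (simp add: q_def field_simps)
    have "(\<Sum>x\<in>UNIV. M $ k $ x * N $ x $ l) = (if k = l then 1 else 0)" for k l
    proof -
      have "(\<Sum>x\<in>UNIV. B $ k $ x * N $ x $ l) = (\<Sum>x\<in>UNIV. B $ k $ x * R $ x $ l)
          - q * R $ j $ l * (\<Sum>x\<in>UNIV. B $ k $ x * R $ x $ j)"
        by (simp add: N_def algebra_simps sum_subtractf sum_distrib_left)
      then have "(\<Sum>x\<in>UNIV. M $ k $ x * N $ x $ l) =
          (if k = l then 1 else 0) - q * R $ j $ l * (if k = j then 1 else 0)
          + (if k = j then s * N $ j $ l else 0)"
        unfolding M_sum by (simp only: BR)
      also have "\<dots> = (if k = l then 1 else 0)
          + (if k = j then (s - q - s * q * R $ j $ j) * R $ j $ l else 0)"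
        by (simp add: N_def algebra_simps)
      finally show ?thesis
        by (simp add: q)
    qed
    then show ?thesis
      by (simp add: matrix_matrix_mult_def vec_eq_iff mat_def)
  qed
  have "\<not> invertible M" if "1 + s * R $ j $ j = 0"
  proof
    assume "invertible M"
    then obtain M' where inv: "M' ** M = mat 1"
      by (auto simp: invertible_def)
    \<comment> \<open>\<open>M\<close> maps column \<open>j\<close> of \<open>R\<close> to
      \<open>1 + s * R $ j $ j\<close> times the \<open>j\<close>-th unit vector, so the column lies
      in the kernel.\<close>
    have "M *v column j R = 0"
      using that by (auto simp: matrix_vector_mult_def column_def vec_eq_iff M_sum BR)
    then have "M' *v (M *v column j R) = 0"
      by simp
    then have "column j R = 0"
      by (simp add: matrix_vector_mul_assoc inv)
    then have "R $ j $ j = 0"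
      by (simp add: column_def vec_eq_iff)
    with that show False
      by simp
  qed
  with matrix_inv_unique(1)[OF MN] show inv: "invertible M \<longleftrightarrow> 1 + s * R $ j $ j \<noteq> 0"
    by blast
  show "matrix_inv M $ k $ l = R $ k $ l - s * R $ k $ j * R $ j $ l / (1 + s * R $ j $ j)"
    if "invertible M"
    using matrix_inv_unique(2)[OF MN] that inv by (simp add: N_def q_def)
qed

section \<open>Power series solutions and their differences\<close>

text \<open>
  Solving \<open>f = a\<close> for \<open>w\<close> first gives \<open>w = 1/t + (t p\<^sub>i\<^sub>i + a) / (t d\<^sub>a)\<close>. The pole at \<open>t = 0\<close> cancels because
  \<open>p\<^sub>j\<^sub>j = 1 + t s\<close>, where \<open>s\<close> is the sum of the \<open>p\<^sub>x\<^sub>j\<close> over the neighbours \<open>x\<close> of \<open>j\<close>.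
\<close>

definition level_denominator :: "('v::finite \<times> 'v) set \<Rightarrow> 'v \<Rightarrow> 'v \<Rightarrow> complex \<Rightarrow> complex fps" where
  "level_denominator E i j a = fps_X * walk_fps E i j ^ 2
     - (fps_X * walk_fps E i i + fps_const a) * walk_fps E j j"

definition level_fps :: "('v::finite \<times> 'v) set \<Rightarrow> 'v \<Rightarrow> 'v \<Rightarrow> complex \<Rightarrow> complex fps" where
  "level_fps E i j a =
     (walk_fps E i j ^ 2
       - (fps_X * walk_fps E i i + fps_const a) * (\<Sum>x | (j, x) \<in> E. walk_fps E x j))
     / level_denominator E i j a"

text \<open>For nonzero \<open>a\<close> the denominator is therefore a unit, and the division in
  \<open>level_fps\<close> is exact.\<close>

lemma level_denominator_nth_0: "fps_nth (level_denominator E i j a) 0 = - a"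
  by (simp add: level_denominator_def walk_fps_nth)

text \<open>After cross-multiplication the terms free of \<open>p\<close> and those in
  \<open>p ^ 4\<close> cancel. What remains is \<open>(a - b) * p ^ 2 * (q - fps_X * s)\<close>,
  whose last factor is 1.\<close>

lemma level_fps_diff:
  assumes "a \<noteq> 0" and "b \<noteq> 0"
  shows "(level_fps E i j a - level_fps E i j b) * (level_denominator E i j a * level_denominator E i j b)
    = fps_const (a - b) * walk_fps E i j ^ 2"
proof -
  define p q r s where "p = walk_fps E i j" and "q = walk_fps E j j" and "r = walk_fps E i i"
    and "s = (\<Sum>x | (j, x) \<in> E. walk_fps E x j)"
  have q: "q = 1 + fps_X * s"
    using walk_fps_unfold[of E j j] by (simp add: q_def s_def)
  have level: "level_fps E i j c * level_denominator E i j c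
      = p ^ 2 - (fps_X * r + fps_const c) * s" if "c \<noteq> 0" for c
  proof -
    have "level_denominator E i j c dvd F" for F
      using that by (intro fps_unit_dvd) (simp add: level_denominator_nth_0)
    then show ?thesis
      unfolding level_fps_def p_def r_def s_def by (rule dvd_div_mult_self)
  qed
  have "(level_fps E i j a - level_fps E i j b) * (level_denominator E i j a * level_denominator E i j b)
      = (level_fps E i j a * level_denominator E i j a) * level_denominator E i j b
        - (level_fps E i j b * level_denominator E i j b) * level_denominator E i j a"
    by (simp add: algebra_simps)
  also have "\<dots> = (fps_const a - fps_const b) * p ^ 2"
    unfolding level[OF assms(1)] level[OF assms(2)]
    unfolding level_denominator_def p_def[symmetric] q_def[symmetric] r_def[symmetric] q
    by (simp add: algebra_simps power2_eq_square del: fps_const_sub)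
  finally show ?thesis
    by (simp add: p_def)
qed

lemma subdegree_level_fps_diff:
  assumes "a \<noteq> 0" "b \<noteq> 0" "a \<noteq> b" and "walk_fps E i j \<noteq> 0"
  shows "level_fps E i j a - level_fps E i j b \<noteq> 0"
    and "subdegree (level_fps E i j a - level_fps E i j b) = 2 * subdegree (walk_fps E i j)"
proof -
  note eq = level_fps_diff[OF assms(1,2), of E i j]
  have rhs: "fps_const (a - b) * walk_fps E i j ^ 2 \<noteq> 0"
    using assms by (simp del: fps_const_sub)
  with eq show nz: "level_fps E i j a - level_fps E i j b \<noteq> 0"
    by auto
  have den: "level_denominator E i j c \<noteq> 0" "subdegree (level_denominator E i j c) = 0"
    if "c \<noteq> 0" for c
    using that level_denominator_nth_0[of E i j c] by (auto simp: subdegree_eq_0_iff)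
  have "subdegree (level_fps E i j a - level_fps E i j b) =
      subdegree (fps_const (a - b) * walk_fps E i j ^ 2)"
    unfolding eq[symmetric] using nz den assms by simp
  also have "\<dots> = 2 * subdegree (walk_fps E i j)"
    using assms by (simp add: subdegree_power)
  finally show "subdegree (level_fps E i j a - level_fps E i j b) = 2 * subdegree (walk_fps E i j)" .
qed

section \<open>Solving the level equation near infinity\<close>

text \<open>The left side is the rank-one formula for \<open>f = a\<close>. With
  \<open>t = 1 / z\<close> and \<open>u = z - w\<close>, clearing its denominator gives the linear
  equation \<open>u * (t * d) = e\<close>.\<close>

lemma level_equation_iff:
  fixes z w a d p q r s :: "'a::field"
  assumes "z \<noteq> 0" "p \<noteq> 0" "d \<noteq> 0"
    and q: "q = 1 + 1 / z * s"
    and d: "d = 1 / z * p ^ 2 - (1 / z * r + a) * q"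
  shows "1 + (z - w) * (- (1 / z) * q) \<noteq> 0 \<and>
      - (1 / z) * r - (z - w) * (- (1 / z) * p) * (- (1 / z) * p) / (1 + (z - w) * (- (1 / z) * q)) = a
    \<longleftrightarrow> w = (p ^ 2 - (1 / z * r + a) * s) / d"
proof -
  define t where "t = 1 / z"
  define e where "e = - (t * r + a)"
  define u where "u = z - w"
  have t: "t \<noteq> 0" and zt: "z * t = 1"
    using assms by (auto simp: t_def)
  have q': "q = 1 + t * s" and d': "d = t * p ^ 2 + e * q"
    using q d by (auto simp: t_def e_def algebra_simps)
  have eq_iff: "1 - u * t * q \<noteq> 0 \<and> - t * r - u * t ^ 2 * p ^ 2 / (1 - u * t * q) = a
      \<longleftrightarrow> u * (t * d) = e"
  proof
    assume "1 - u * t * q \<noteq> 0 \<and> - t * r - u * t ^ 2 * p ^ 2 / (1 - u * t * q) = a"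
    then have nz: "1 - u * t * q \<noteq> 0" and "u * t ^ 2 * p ^ 2 / (1 - u * t * q) = e"
      by (auto simp: e_def algebra_simps)
    then have "u * t ^ 2 * p ^ 2 = e * (1 - u * t * q)"
      by (simp add: divide_eq_eq)
    then show "u * (t * d) = e"
      by (simp add: d' algebra_simps power2_eq_square)
  next
    assume utd: "u * (t * d) = e"
    then have eq: "u * t ^ 2 * p ^ 2 = e * (1 - u * t * q)"
      by (simp add: d' algebra_simps power2_eq_square)
    \<comment> \<open>The solution of the linear equation must not make the matrix singular;
      \<open>p \<noteq> 0\<close> rules this out.\<close>
    have "d * (1 - u * t * q) = d - (u * (t * d)) * q"
      by (simp add: algebra_simps)
    also have "\<dots> = t * p ^ 2"
      unfolding utd by (simp add: d')
    also have "\<dots> \<noteq> 0"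
      using t assms by simp
    finally have "1 - u * t * q \<noteq> 0"
      by auto
    with eq show "1 - u * t * q \<noteq> 0 \<and> - t * r - u * t ^ 2 * p ^ 2 / (1 - u * t * q) = a"
      by (simp add: e_def)
  qed
  also have "u * (t * d) = e \<longleftrightarrow> w * d * t = (p ^ 2 + e * s) * t"
  proof -
    have "u * (t * d) = (z * t) * d - w * d * t"
      by (simp add: u_def algebra_simps)
    then have "u * (t * d) = d - w * d * t"
      by (simp add: zt)
    moreover have "d - e = (p ^ 2 + e * s) * t"
      by (simp add: d' q' algebra_simps)
    moreover have "d - w * d * t = e \<longleftrightarrow> w * d * t = d - e"
      by (auto simp: diff_eq_eq eq_diff_eq add.commute)
    ultimately show ?thesis
      by simp
  qed
  also have "\<dots> \<longleftrightarrow> w = (p ^ 2 + e * s) / d"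
    using t assms by (simp add: eq_divide_eq)
  finally have main: "1 - u * t * q \<noteq> 0 \<and> - t * r - u * t ^ 2 * p ^ 2 / (1 - u * t * q) = a
      \<longleftrightarrow> w = (p ^ 2 + e * s) / d" .
  have "1 + u * (- t * q) = 1 - u * t * q" "u * (- t * p) * (- t * p) = u * t ^ 2 * p ^ 2"
    "p ^ 2 + e * s = p ^ 2 - (t * r + a) * s"
    by (simp_all add: e_def power2_eq_square algebra_simps)
  with main show ?thesis
    unfolding t_def[symmetric] u_def[symmetric] by (simp only:)
qed

text \<open>Each entry of the product is the first-step identity of the walk series at
  \<open>t = 1 / z\<close>. It holds near \<open>t = 0\<close> for all of the finitely many pairs of
  vertices at once.\<close>

lemma eventually_adj_matrix_resolvent:
  "\<forall>\<^sub>F z in at_infinity.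
     (adj_matrix G - mat z) ** (\<chi> k l. - (1 / z) * eval_fps (walk_fps (parcs G) k l) (1 / z)) = mat 1"
proof -
  have lim: "filterlim (\<lambda>z::complex. 1 / z) (nhds 0) at_infinity"
    using tendsto_inverse_0[where 'a = complex] unfolding inverse_eq_divide .
  have "\<forall>\<^sub>F z in at_infinity. \<forall>u v. eval_fps (walk_fps (parcs G) u v) (1 / z) =
     (if u = v then 1 else 0)
     + 1 / z * (\<Sum>x | (u, x) \<in> parcs G. eval_fps (walk_fps (parcs G) x v) (1 / z))"
    by (intro eventually_all_finite,
        rule eventually_compose_filterlim[OF eventually_eval_walk_fps_unfold lim])
  moreover have "\<forall>\<^sub>F z in at_infinity. z \<noteq> (0::complex)"
    by (rule eventually_not_equal_at_infinity)
  ultimately show ?thesis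
  proof eventually_elim
    case (elim z)
    let ?p = "\<lambda>u v. eval_fps (walk_fps (parcs G) u v) (1 / z)"
    have "(\<Sum>x\<in>UNIV. (adj_matrix G - mat z) $ u $ x * (- (1 / z) * ?p x v)) = (if u = v then 1 else 0)"
      for u v
    proof -
      have "(\<Sum>x\<in>UNIV. (adj_matrix G - mat z) $ u $ x * (- (1 / z) * ?p x v))
          = (\<Sum>x\<in>UNIV. (if x = u then ?p x v else 0)
              - (if (u, x) \<in> parcs G then 1 / z * ?p x v else 0))"
        using elim(2) by (intro sum.cong) (auto simp: adj_matrix_def mat_def algebra_simps)
      also have "\<dots> = ?p u v - 1 / z * (\<Sum>x | (u, x) \<in> parcs G. ?p x v)"
        using sum.inter_filter[of UNIV "\<lambda>x. 1 / z * ?p x v" "\<lambda>x. (u, x) \<in> parcs G"]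
        by (simp add: sum_subtractf sum_distrib_left)
      also have "\<dots> = (if u = v then 1 else 0)"
        by (subst elim(1)[rule_format]) simp
      finally show ?thesis .
    qed
    then show ?case
      by (simp add: matrix_matrix_mult_def vec_eq_iff mat_def)
  qed
qed

lemma solved_at_infinity_level_fps:
  fixes G :: "'v::finite pair_pre_digraph"
  assumes "sym (parcs G)" and "c j = W" and c: "\<And>k. k \<noteq> j \<Longrightarrow> c k = Z"
    and nz: "walk_fps (parcs G) i j \<noteq> 0" and "\<alpha> \<noteq> 0"
  shows "solved_at_infinity (representing_function G c i) \<alpha>
    (level_fps (parcs G) i j (of_real \<alpha>))"
proof -
  define E where "E = parcs G"
  define a where "a = complex_of_real \<alpha>"
  define p where "p = (\<lambda>u v. eval_fps (walk_fps E u v))"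
  define d where "d = (\<lambda>t. t * p i j t ^ 2 - (t * p i i t + a) * p j j t)"
  define s where "s = (\<lambda>t. \<Sum>x | (j, x) \<in> E. p x j t)"
  have a: "a \<noteq> 0"
    using assms(5) by (simp add: a_def)
  have expansion: "p u v has_fps_expansion walk_fps E u v" for u v
    unfolding p_def by (rule has_fps_expansion_walk_fps)
  have d_expansion: "d has_fps_expansion level_denominator E i j a"
    unfolding d_def level_denominator_def power2_eq_square
    by (intro fps_expansion_intros expansion)
  have "(\<lambda>t. (p i j t ^ 2 - (t * p i i t + a) * s t) / d t) has_fps_expansion level_fps E i j a"
    unfolding level_fps_def s_def power2_eq_square
    using a by (intro fps_expansion_intros expansion d_expansion) (simp add: level_denominator_nth_0)
  then have radius: "fps_conv_radius (level_fps E i j a) > 0"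
    and eval: "\<forall>\<^sub>F t in nhds 0. eval_fps (level_fps E i j a) t =
        (p i j t ^ 2 - (t * p i i t + a) * s t) / d t"
    by (auto simp: has_fps_expansion_def)
  have "level_denominator E i j a \<noteq> 0"
    using a level_denominator_nth_0[of E i j a] by auto
  then have d_nz: "\<forall>\<^sub>F t in at 0. d t \<noteq> 0"
    by (rule has_fps_expansion_eventually_nonzero[OF d_expansion])
  have p_nz: "\<forall>\<^sub>F t in at 0. p i j t \<noteq> 0"
    using nz by (intro has_fps_expansion_eventually_nonzero[OF expansion]) (simp add: E_def)
  \<comment> \<open>The update formula yields the product of \<open>p i j\<close> and
    \<open>p j i\<close>; by symmetry of the graph it is a square.\<close>
  have p_commute: "p u v = p v u" for u v
    using assms(1) by (simp add: p_def walk_fps_def E_def walk_count_commute[of _ _ u v])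
  \<comment> \<open>The punctured filter \<open>at 0\<close> matters: \<open>p i j\<close> vanishes
    at 0 itself whenever \<open>i\<close> and \<open>j\<close> differ.\<close>
  have lim: "filterlim (\<lambda>z::complex. 1 / z) (at 0) at_infinity"
    using filterlim_ident[of at_infinity] by (simp add: filterlim_inverse_at_iff flip: inverse_eq_divide)
  have at_nhds: "\<forall>\<^sub>F t in at 0. P t" if "\<forall>\<^sub>F t in nhds 0. P t" for P :: "complex \<Rightarrow> bool"
    using that by (auto simp: eventually_at_filter elim: eventually_mono)
  have q: "\<forall>\<^sub>F t in nhds 0. p j j t = 1 + t * s t"
    using eventually_eval_walk_fps_unfold[of E j j] by (simp add: p_def s_def)
  have "\<forall>\<^sub>F z in at_infinity. \<forall>w. representing_function G c i z w = Some a \<longleftrightarrow>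
      w = eval_fps (level_fps E i j a) (1 / z)"
    using eventually_adj_matrix_resolvent[of G] eventually_not_equal_at_infinity[of 0]
      eventually_compose_filterlim[OF d_nz lim] eventually_compose_filterlim[OF p_nz lim]
      eventually_compose_filterlim[OF at_nhds[OF eval] lim]
      eventually_compose_filterlim[OF at_nhds[OF q] lim]
  proof eventually_elim
    case (elim z)
    show ?case
    proof
      fix w
      let ?R = "\<chi> k l. - (1 / z) * p k l (1 / z)"
      have M: "colored_adj_matrix G c z w $ k $ l =
          (adj_matrix G - mat z) $ k $ l + (if k = j \<and> l = j then z - w else 0)" for k l
        using assms(2) c[of k] by (auto simp: colored_adj_matrix_def color_matrix_def mat_def)
      have BR: "(adj_matrix G - mat z) ** ?R = mat 1"
        using elim(1) by (simp add: p_def E_def)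
      note perturbation = rank_one_perturbation[OF BR M]
      have "representing_function G c i z w = Some a \<longleftrightarrow>
          1 + (z - w) * ?R $ j $ j \<noteq> 0 \<and>
          ?R $ i $ i - (z - w) * ?R $ i $ j * ?R $ j $ i / (1 + (z - w) * ?R $ j $ j) = a"
        using perturbation by (auto simp: representing_function_def)
      also have "\<dots> \<longleftrightarrow> w = (p i j (1 / z) ^ 2 - (1 / z * p i i (1 / z) + a) * s (1 / z)) / d (1 / z)"
        using level_equation_iff[OF elim(2) elim(4) elim(3) elim(6), of "p i i (1 / z)" a w]
        by (simp add: p_commute[of j i] d_def)
      finally show "representing_function G c i z w = Some a \<longleftrightarrow>
          w = eval_fps (level_fps E i j a) (1 / z)"
        using elim(5) by simp
    qed
  qed
  with radius show ?thesis
    by (simp add: solved_at_infinity_def E_def a_def)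
qed

section \<open>Order of the walk series and distance\<close>

text \<open>A shortest path is a walk, so coefficient \<open>n\<close> is nonzero. A walk of length
  below \<open>n\<close> would shrink to a path below the minimum, so earlier coefficients
  vanish.\<close>

lemma subdegree_walk_fps:
  fixes G :: "'v::finite pair_pre_digraph"
  assumes "pair_wf_digraph G" and "pverts G = UNIV"
    and "\<exists>p. path_between G i p j"
  shows "walk_fps (parcs G) i j \<noteq> 0"
    and "subdegree (walk_fps (parcs G) i j) = min_path_length G i j"
proof -
  interpret pair_wf_digraph G by fact
  define n where "n = min_path_length G i j"
  have "\<exists>p. path_between G i p j \<and> length p = n"
    unfolding n_def min_path_length_def using assms(3) by (auto intro: LeastI)
  then obtain p where "apath i p j" "length p = n"
    by (auto simp: path_between_def)
  then have "0 < walk_count (parcs G) n i j"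
    using assms by (auto simp: walk_count_pos_iff apath_def)
  then have nth: "fps_nth (walk_fps (parcs G) i j) n \<noteq> 0"
    by (simp add: walk_fps_nth)
  then show "walk_fps (parcs G) i j \<noteq> 0"
    by auto
  have "walk_count (parcs G) m i j = 0" if "m < n" for m
  proof (rule ccontr)
    assume "walk_count (parcs G) m i j \<noteq> 0"
    then obtain p where "awalk i p j" "length p = m"
      using walk_count_pos_iff[OF assms(1,2), of m i j] by auto
    then obtain q where "apath i q j" "length q \<le> m"
      using awalk_imp_shorter_apath by blast
    then have "n \<le> length q"
      unfolding n_def min_path_length_def path_between_def by (intro Least_le) auto
    with \<open>length q \<le> m\<close> that show False
      by simp
  qed
  with nth show "subdegree (walk_fps (parcs G) i j) = min_path_length G i j"
    unfolding n_def[symmetric] by (intro subdegreeI) (auto simp: walk_fps_nth)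
qed

theorem theorem4p6:
  fixes G :: "'v::finite pair_pre_digraph"
    and c :: "'v \<Rightarrow> color"
    and i j :: 'v
    and n :: nat
  assumes "pair_graph G" and "pverts G = UNIV"
    and "c j = W" and "\<And>k. k \<noteq> j \<Longrightarrow> c k = Z"
    and "\<exists>p. path_between G i p j"
    and "n = min_path_length G i j"
  shows "has_order_of_contact (representing_function G c i) (2 * n)"
proof -
  interpret pair_graph G by fact
  have "sym (parcs G)"
    using pair_sym_arcs by (simp add: symmetric_def)
  note walk = subdegree_walk_fps[OF pair_wf_digraph_axioms assms(2,5)]
  show ?thesis
    unfolding has_order_of_contact_def
  proof (intro exI conjI allI impI)
    \<comment> \<open>Only the level 0 is excluded, where the denominator has constant term
      0.\<close>
    show "finite {0::real}"
      by simp
    fix \<alpha> :: real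
    assume \<alpha>: "\<alpha> \<notin> {0}"
    show "solved_at_infinity (representing_function G c i) \<alpha> (level_fps (parcs G) i j (of_real \<alpha>))"
      using \<alpha> by (intro solved_at_infinity_level_fps \<open>sym (parcs G)\<close> assms(3,4) walk(1)) auto
    fix \<beta> :: real
    assume "\<beta> \<notin> {0}" "\<alpha> \<noteq> \<beta>"
    with \<alpha> have nz: "complex_of_real \<alpha> \<noteq> 0" "complex_of_real \<beta> \<noteq> 0"
      "complex_of_real \<alpha> \<noteq> of_real \<beta>"
      by auto
    note diff = subdegree_level_fps_diff[OF nz walk(1)]
    show "level_fps (parcs G) i j (of_real \<alpha>) - level_fps (parcs G) i j (of_real \<beta>) \<noteq> 0"
      by (rule diff(1))
    show "subdegree (level_fps (parcs G) i j (of_real \<alpha>) - level_fps (parcs G) i j (of_real \<beta>)) = 2 * n"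
      by (simp add: diff(2) walk(2) assms(6))
  qed
qed

end
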